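(* For any integer $n\geq 2$, the involutory Cayley graph $\mathcal{G}(\mathbb{Z}_n[x])$ of $\mathbb{Z}_n[x]$ has infinitely many connected components.
   Context: $\mathbb{Z}_n$ denotes the ring of integers modulo $n$. For a commutative ring $R$ with identity, the involutory Cayley graph $\mathcal{G}(R)$ is the simple undirected graph with vertex set $R$ in which two vertices $a,b$ are adjacent if and only if $(a-b)^2=1$. *)

theory Defs
  imports
    "HOL-Number_Theory.Residues"
    "HOL-Algebra.UnivPoly"
    "Graph_Theory.Graph_Theory"
begin

(* An undirected edge {a, b} is represented by the two arcs (a, b) and (b, a); see
   bidirected_involutory_cayley_graph below. The conjunct a \<noteq> b only matters for the
   zero ring, where (a - a)^2 = 1. *)
definition involutory_cayley_graph :: "('a, 'm) ring_scheme \<Rightarrow> 'a pair_pre_digraph" where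
  "involutory_cayley_graph R =
     \<lparr> pverts = carrier R,
       parcs = {(a, b). a \<in> carrier R \<and> b \<in> carrier R \<and> a \<noteq> b \<and>
                  (a \<ominus>\<^bsub>R\<^esub> b) [^]\<^bsub>R\<^esub> (2::nat) = \<one>\<^bsub>R\<^esub>} \<rparr>"

definition connected_components :: "('a, 'b) pre_digraph \<Rightarrow> ('a, 'b) pre_digraph set" where
  "connected_components G = {H. pre_digraph.max_subgraph G Digraph_Component.connected H}"

lemma bidirected_involutory_cayley_graph:
  assumes "cring R"
  shows "pair_bidirected_digraph (involutory_cayley_graph R)"
proof -
  interpret cring R by fact
  have swap: "(b \<ominus>\<^bsub>R\<^esub> a) [^]\<^bsub>R\<^esub> (2::nat) = (a \<ominus>\<^bsub>R\<^esub> b) [^]\<^bsub>R\<^esub> (2::nat)"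
    if "a \<in> carrier R" "b \<in> carrier R" for a b
  proof -
    have "b \<ominus>\<^bsub>R\<^esub> a = \<ominus>\<^bsub>R\<^esub> (a \<ominus>\<^bsub>R\<^esub> b)"
      using that by (simp add: a_minus_def minus_add a_comm)
    then show ?thesis
      using that by (simp add: numeral_2_eq_2 l_minus r_minus)
  qed
  show ?thesis
    by unfold_locales
      (auto simp: involutory_cayley_graph_def symmetric_def swap intro!: symI)
qed

end

theory Submission
  imports Defs
begin

text \<open>
  The idea is that a square root of 1 in \<open>R[x]\<close> is constant modulo every prime ideal \<open>I\<close> of \<open>R\<close>:
  the quotient \<open>R/I\<close> is a domain, so degrees add in \<open>(R/I)[x]\<close> and \<open>u\<^sup>2 = 1\<close> forces the reduction of
  \<open>u\<close> to have degree 0 (\<open>coeff_in_primeideal_if_square_one\<close>). Over \<open>\<int>\<^sub>4\<close>, say, \<open>u\<close> itself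
  can have any degree, since \<open>(1 + 2 f)\<^sup>2 = 1\<close> for all \<open>f\<close>; this is why one reduces first.

  Adjacent polynomials differ by a square root of 1, so along every walk in the involutory Cayley
  graph of \<open>R[x]\<close> the nonconstant coefficients stay the same modulo \<open>I\<close>
  (\<open>reachable_coeff_congruent\<close>). Any two of the monomials \<open>x, x\<^sup>2, x\<^sup>3, \<dots>\<close> differ in such a
  coefficient by 1 or -1, which is not in \<open>I\<close>, so they lie in different components. For
  \<open>R = \<int>\<^sub>n\<close> with \<open>n \<ge> 2\<close> a suitable \<open>I\<close> is the set of multiples of a prime factor of \<open>n\<close>.
\<close>

text \<open>
  The set of vertices reachable from \<open>u\<close> induces a strongly connected component, which by
  definition is maximal among the strongly connected subgraphs only. A connected
  subgraph of a symmetric digraph need not itself be symmetric, so maximality among the weakly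
  connected subgraphs is a further claim; it holds because symmetry of the ambient graph lets one
  walk arcs of the subgraph backwards.
\<close>

lemma (in sym_digraph) induce_reachable_in_connected_components:
  assumes "u \<in> verts G"
  shows "G \<restriction> {v. u \<rightarrow>\<^sup>* v} \<in> connected_components G"
proof -
  let ?C = "G \<restriction> {v. u \<rightarrow>\<^sup>* v}"
  have "?C \<in> sccs"
    using assms by (rule induce_reachable_is_in_sccs)
  then have ind: "induced_subgraph ?C G" and sc: "strongly_connected ?C"
    by (auto elim: in_sccsE)
  interpret C: wf_digraph ?C
    using ind by (rule wf_digraphI_induced)
  have "connected ?C"
    using sc by (auto simp: connected_def strongly_connected_def intro: C.reachable_mk_symmetricI)
  moreover have "H = ?C" if sub: "subgraph ?C H" "subgraph H G" and con: "connected H" for H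
  proof -
    have "u \<in> verts H"
      using subgraph_imp_subverts[OF sub(1)] assms by auto
    then have "u \<rightarrow>\<^sup>*\<^bsub>mk_symmetric H\<^esub> v" if "v \<in> verts H" for v
      using con that by (auto simp: connected_def strongly_connected_def)
    then have "u \<rightarrow>\<^sup>*\<^bsub>mk_symmetric G\<^esub> v" if "v \<in> verts H" for v
      using that subgraph_mk_symmetric[OF sub(2)] by (blast intro: pre_digraph.reachable_mono)
    then have "verts H \<subseteq> verts ?C"
      by (auto simp: reachable_mk_symmetric_eq[OF sym_arcs])
    moreover have "tail H = tail G" "head H = head G" "wf_digraph H"
      using sub(2) by (auto simp: subgraph_def compatible_def)
    moreover have "verts ?C \<subseteq> verts H" "arcs ?C \<subseteq> arcs H" "arcs H \<subseteq> arcs G"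
      using sub by (auto simp: subgraph_def)
    moreover have "arcs H \<subseteq> arcs ?C"
    proof
      fix e assume e: "e \<in> arcs H"
      then have "tail H e \<in> verts H" "head H e \<in> verts H"
        using \<open>wf_digraph H\<close> by (auto dest: wf_digraph.wellformed)
      then show "e \<in> arcs ?C"
        using e calculation by auto
    qed
    ultimately show "H = ?C"
      by (intro pre_digraph.equality) (auto simp: subset_antisym)
  qed
  ultimately show ?thesis
    using ind unfolding connected_components_def
    by (auto intro!: max_subgraphI)
qed

lemma (in sym_digraph) infinite_connected_components_if_unreachable:
  fixes f :: "nat \<Rightarrow> 'a"
  assumes "\<And>j. f j \<in> verts G" and unreachable: "\<And>j k. f j \<rightarrow>\<^sup>* f k \<Longrightarrow> j = k"
  shows "infinite (connected_components G)"
proof -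
  let ?C = "\<lambda>j. G \<restriction> {v. f j \<rightarrow>\<^sup>* v}"
  have "inj ?C"
  proof (rule injI)
    fix j k assume "?C j = ?C k"
    then have "verts (?C j) = verts (?C k)"
      by (rule arg_cong)
    then show "j = k"
      using assms(1)[of k] by (auto intro: unreachable)
  qed
  moreover have "range ?C \<subseteq> connected_components G"
    using assms(1) induce_reachable_in_connected_components by blast
  ultimately show ?thesis
    using finite_subset range_inj_infinite by metis
qed

lemma (in ideal) finsum_in_ideal:
  assumes "\<And>i. i \<in> A \<Longrightarrow> f i \<in> I"
  shows "(\<Oplus>i\<in>A. f i) \<in> I"
  using assms
proof (induction A rule: infinite_finite_induct)
  case (insert i A)
  moreover have "f \<in> A \<rightarrow> carrier R" "f i \<in> carrier R"
    using insert.prems by (auto intro: Icarr)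
  ultimately show ?case
    by simp
qed (auto simp: finsum_infinite)

context UP_cring
begin

text \<open>
  Let \<open>d\<close> be the degree of \<open>u\<close> modulo \<open>I\<close>. Modulo \<open>I\<close> only the square of the \<open>d\<close>-th coefficient
  survives in the coefficient of \<open>u\<^sup>2\<close> at \<open>2 d\<close>, and it is nonzero as \<open>I\<close> is prime. But 1 has no
  nonzero coefficient at a positive exponent.
\<close>

lemma coeff_in_primeideal_if_square_one:
  assumes I: "primeideal I R"
    and u: "u \<in> carrier P" and sq: "u \<otimes>\<^bsub>P\<^esub> u = \<one>\<^bsub>P\<^esub>"
    and "k > 0"
  shows "coeff P u k \<in> I"
proof (rule ccontr)
  assume k: "coeff P u k \<notin> I"
  interpret I: primeideal I R by (rule I)
  let ?c = "coeff P u"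
  let ?S = "{i. ?c i \<notin> I}"
  define d where "d = Max ?S"
  obtain b where "bound \<zero> b ?c"
    using u by (auto simp: UP_def P_def)
  then have "?S \<subseteq> {..b}"
    using I.zero_closed by (auto simp: bound_def not_less[symmetric])
  then have fin: "finite ?S"
    by (rule finite_subset) simp
  have "d \<in> ?S"
    unfolding d_def using fin k by (intro Max_in) auto
  have "k \<le> d"
    unfolding d_def using fin k by (intro Max_ge) auto
  have above: "?c i \<in> I" if "i > d" for i
    using that Max_ge[OF fin, of i] by (auto simp: d_def)
  have c: "?c i \<in> carrier R" for i
    using u by simp
  let ?t = "\<lambda>i. ?c i \<otimes> ?c (2 * d - i)"
  have rest: "(\<Oplus>i\<in>{..2 * d} - {d}. ?t i) \<in> I"
  proof (rule I.finsum_in_ideal)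
    fix i assume "i \<in> {..2 * d} - {d}"
    then consider "i > d" | "2 * d - i > d" by force
    then show "?t i \<in> I"
      using above c by cases (auto intro: I.I_l_closed I.I_r_closed)
  qed
  have "\<zero> = coeff P (u \<otimes>\<^bsub>P\<^esub> u) (2 * d)"
    using \<open>k > 0\<close> \<open>k \<le> d\<close> by (simp add: sq)
  also have "\<dots> = (\<Oplus>i\<in>insert d ({..2 * d} - {d}). ?t i)"
    using u by (simp add: insert_absorb)
  also have "\<dots> = ?t d \<oplus> (\<Oplus>i\<in>{..2 * d} - {d}. ?t i)"
    using c by (subst R.finsum_insert) auto
  finally have "\<zero> = ?t d \<oplus> (\<Oplus>i\<in>{..2 * d} - {d}. ?t i)" .
  then have "?t d = \<ominus> (\<Oplus>i\<in>{..2 * d} - {d}. ?t i)"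
    using c by (intro R.minus_equality[symmetric]) auto
  then have "?c d \<otimes> ?c d \<in> I"
    using I.a_inv_closed[OF rest] by (simp add: mult_2)
  then show False
    using I.I_prime[OF c c] \<open>d \<in> ?S\<close> by auto
qed

lemma reachable_coeff_congruent:
  assumes I: "primeideal I R"
    and reach: "f \<rightarrow>\<^sup>*\<^bsub>with_proj (involutory_cayley_graph P)\<^esub> g"
    and "k > 0"
  shows "coeff P f k \<ominus> coeff P g k \<in> I"
proof -
  interpret I: primeideal I R by (rule I)
  interpret G: pair_bidirected_digraph "involutory_cayley_graph P"
    by (rule bidirected_involutory_cayley_graph) (rule UP_cring)
  show ?thesis
    using reach
  proof (induction rule: G.reachable_induct)
    case base
    then have "coeff P f k \<in> carrier R"
      by (simp add: involutory_cayley_graph_def)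
    then show ?case
      by (simp add: R.minus_eq R.r_neg)
  next
    case (step g h)
    then have carrier: "g \<in> carrier P" "h \<in> carrier P" and
        sq: "(g \<ominus>\<^bsub>P\<^esub> h) [^]\<^bsub>P\<^esub> (2::nat) = \<one>\<^bsub>P\<^esub>"
      by (auto simp: involutory_cayley_graph_def arcs_ends_conv)
    have "f \<in> carrier P"
      using G.reachable_in_verts(1)[OF step.hyps(1)] by (simp add: involutory_cayley_graph_def)
    then have f: "coeff P f k \<in> carrier R" and g: "coeff P g k \<in> carrier R"
      and h: "coeff P h k \<in> carrier R"
      using carrier by auto
    have "coeff P (g \<ominus>\<^bsub>P\<^esub> h) k \<in> I"
      using I sq carrier \<open>k > 0\<close>
      by (intro coeff_in_primeideal_if_square_one) (auto simp: numeral_2_eq_2)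
    then have "coeff P g k \<ominus> coeff P h k \<in> I"
      using carrier by (simp add: P.minus_eq R.minus_eq)
    with step.IH have "(coeff P f k \<ominus> coeff P g k) \<oplus> (coeff P g k \<ominus> coeff P h k) \<in> I"
      by simp
    also have "(coeff P f k \<ominus> coeff P g k) \<oplus> (coeff P g k \<ominus> coeff P h k) =
        coeff P f k \<ominus> coeff P h k"
      using f g h by algebra
    finally show ?case .
  qed
qed

theorem infinite_connected_components_if_primeideal:
  assumes I: "primeideal I R"
  shows "infinite (connected_components (with_proj (involutory_cayley_graph P)))"
proof -
  interpret I: primeideal I R by (rule I)
  interpret G: pair_bidirected_digraph "involutory_cayley_graph P"
    by (rule bidirected_involutory_cayley_graph) (rule UP_cring)
  \<comment> \<open>Exponents start at 1: the constant coefficient is not an invariant.\<close>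
  let ?x = "\<lambda>j. monom P \<one> (Suc j)"
  show ?thesis
  proof (rule G.infinite_connected_components_if_unreachable[where f = ?x])
    show "?x j \<in> pverts (involutory_cayley_graph P)" for j
      by (simp add: involutory_cayley_graph_def)
    show "j = k" if reach: "?x j \<rightarrow>\<^sup>*\<^bsub>with_proj (involutory_cayley_graph P)\<^esub> ?x k" for j k
    proof (rule ccontr)
      assume "j \<noteq> k"
      then have "\<one> \<in> I"
        using reachable_coeff_congruent[OF I reach, of "Suc j"] by (simp add: R.minus_eq)
      then show False
        using I.one_imp_carrier I.I_notcarr by simp
    qed
  qed
qed

end

lemma (in residues) primeideal_multiples:
  assumes p: "prime p" and "p dvd m"
  shows "primeideal {a \<in> carrier R. p dvd a} R"
proof (rule primeidealI)
  note dvd_mod = dvd_mod_iff[OF \<open>p dvd m\<close>]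
  show "ideal {a \<in> carrier R. p dvd a} R"
  proof (rule idealI)
    show "subgroup {a \<in> carrier R. p dvd a} (add_monoid R)"
    proof (rule subgroup.intro)
      fix a assume a: "a \<in> {a \<in> carrier R. p dvd a}"
      then have "\<ominus> a \<in> {a \<in> carrier R. p dvd a}"
        by (auto simp: res_neg_eq dvd_mod)
      then show "inv\<^bsub>add_monoid R\<^esub> a \<in> {a \<in> carrier R. p dvd a}"
        by (simp add: a_inv_def)
    qed (auto simp: res_add_eq dvd_mod, auto simp: res_zero_eq)
  qed (use ring_axioms in \<open>auto simp: res_mult_eq dvd_mod\<close>)
  have "\<one> \<notin> {a \<in> carrier R. p dvd a}"
    using p by (auto simp: res_one_eq not_prime_unit)
  then show "carrier R \<noteq> {a \<in> carrier R. p dvd a}"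
    using one_closed by blast
  show "a \<in> {a \<in> carrier R. p dvd a} \<or> b \<in> {a \<in> carrier R. p dvd a}"
    if "a \<in> carrier R" "b \<in> carrier R" "a \<otimes> b \<in> {a \<in> carrier R. p dvd a}" for a b
    using that p by (auto simp: res_mult_eq dvd_mod prime_dvd_mult_iff)
qed (rule cring)

theorem theorem3p1:
  fixes n :: int
  assumes "n \<ge> 2"
  shows "infinite (connected_components
           (with_proj (involutory_cayley_graph (UP (residue_ring n)))))"
proof -
  interpret residues n "residue_ring n"
    using assms by unfold_locales auto
  interpret UP_cring "residue_ring n" "UP (residue_ring n)"
    by (rule UP_cring.intro) (rule cring)
  obtain p where "prime p" "p dvd n"
    using assms prime_divisor_exists[of n] by auto
  then show ?thesis
    using infinite_connected_components_if_primeideal primeideal_multiples by blast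
qed

end
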